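(* For every integer $k\ge1$, the number of domino tilings of a $k\times 2k$ rectangle is congruent to $1$ modulo $4$.
   Context: A domino tiling of a $k\times 2k$ rectangle of unit squares is a partition of its squares into pairs of edge-adjacent squares. *)

theory Defs
  imports "HOL-Library.Disjoint_Sets" "HOL-Number_Theory.Cong"
begin

text \<open>The pair \<open>(i, j)\<close> stands for the unit square \<open>[i, i + 1] \<times> [j, j + 1]\<close>.\<close>

type_synonym cell = "nat \<times> nat"

definition rectangle :: "nat \<Rightarrow> nat \<Rightarrow> cell set" where
  "rectangle m n = {..<m} \<times> {..<n}"

definition edge_adjacent :: "cell \<Rightarrow> cell \<Rightarrow> bool" where
  "edge_adjacent a b \<longleftrightarrow>
     fst a = fst b \<and> (snd a = Suc (snd b) \<or> snd b = Suc (snd a)) \<or>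
     snd a = snd b \<and> (fst a = Suc (fst b) \<or> fst b = Suc (fst a))"

definition domino :: "cell set \<Rightarrow> bool" where
  "domino d \<longleftrightarrow> (\<exists>a b. edge_adjacent a b \<and> d = {a, b})"

definition domino_tilings :: "nat \<Rightarrow> nat \<Rightarrow> cell set set set" where
  "domino_tilings m n = {T. partition_on (rectangle m n) T \<and> (\<forall>d\<in>T. domino d)}"

end

theory Submission
  imports Defs
begin

text \<open>Cut the \<open>k \<times> 2k\<close> rectangle into two \<open>k \<times> k\<close> squares. A tiling is determined by the set \<open>D\<close> of
  dominoes that cross the cut, together with a tiling of what \<open>D\<close> leaves of each square. The two
  remainders are mirror images, so the number of tilings is the sum of the squares \<open>x\<^sub>D\<^sup>2\<close>, where
  \<open>x\<^sub>D\<close> counts the tilings of the left square with the cells covered by \<open>D\<close>, all in its last column,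
  removed. Modulo \<open>4\<close> a square is \<open>0\<close> or \<open>1\<close> according to the parity of its root, so it is enough to
  see that \<open>x\<^sub>D\<close> is odd exactly when \<open>D\<close> removes the entire last column.

  Parity is controlled by linear algebra over the field with two elements: a bipartite graph has an
  even number of perfect matchings as soon as some nonempty set \<open>F\<close> of vertices of one colour meets
  every neighbourhood in an even number of vertices, because then the adjacency matrix is singular.
  The lemma \<open>even_card_tilings_if_even_neighbourhoods\<close> proves this by counting. If \<open>D\<close> spares the
  cell in row \<open>i\<close> of the last column, send a billiard ball diagonally from that cell; its
  closed path bounds a tilted rectangle, whose cells of the starting colour form such a set \<open>F\<close>. The
  spared cell is the only one of \<open>F\<close> in the last column, so \<open>F\<close> avoids the cells that \<open>D\<close> covers,
  and \<open>x\<^sub>D\<close> is even.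

  If \<open>D\<close> removes the whole column, \<open>x\<^sub>D\<close> counts the tilings of the \<open>k \<times> (k - 1)\<close> rectangle.
  Transpose this almost-square and cut it into a square and a single column. By the same evenness
  only one term of the cut can be odd, and that term is the number of tilings of the next smaller
  almost-square; so the number is odd by induction.\<close>

section \<open>Tilings of arbitrary regions\<close>

definition tilings :: "cell set \<Rightarrow> cell set set set" where
  "tilings R = {T. partition_on R T \<and> (\<forall>d\<in>T. domino d)}"

lemma domino_tilings_eq_tilings_rectangle: "domino_tilings m n = tilings (rectangle m n)"
  by (simp add: domino_tilings_def tilings_def)

lemma finite_rectangle [simp]: "finite (rectangle m n)"
  by (simp add: rectangle_def)

lemma finite_tilings [simp]: "finite R \<Longrightarrow> finite (tilings R)"
  using finitely_many_partition_on[of R] by (auto simp: tilings_def intro: finite_subset[rotated])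

lemma tilings_empty: "tilings {} = {{}}"
  by (auto simp: tilings_def partition_on_empty)

lemma edge_adjacent_sym: "edge_adjacent a b \<longleftrightarrow> edge_adjacent b a"
  by (auto simp: edge_adjacent_def)

lemma edge_adjacent_irrefl: "\<not> edge_adjacent a a"
  by (auto simp: edge_adjacent_def)

lemma domino_pair_iff: "domino {a, b} \<longleftrightarrow> edge_adjacent a b"
  by (metis doubleton_eq_iff domino_def edge_adjacent_sym)

lemma domino_contains_edge:
  assumes "domino d" "u \<in> d"
  obtains w where "edge_adjacent u w" "d = {u, w}"
  using assms by (auto simp: domino_def edge_adjacent_sym insert_commute)

lemma card_tilings_containing:
  assumes "domino d" "d \<subseteq> R"
  shows "card {T \<in> tilings R. d \<in> T} = card (tilings (R - d))"
proof (rule bij_betw_same_card)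
  have "d \<noteq> {}" using assms(1) by (auto simp: domino_def)
  have disj: "disjnt d (\<Union>(T - {d}))" if "T \<in> tilings R" "d \<in> T" for T
    using that by (auto simp: tilings_def partition_on_def disjoint_def disjnt_def)
  have notin: "d \<notin> T \<and> disjnt d (\<Union>T)" if "T \<in> tilings (R - d)" for T
    using that \<open>d \<noteq> {}\<close> by (auto simp: tilings_def partition_on_def disjnt_def)
  show "bij_betw (\<lambda>T. T - {d}) {T \<in> tilings R. d \<in> T} (tilings (R - d))"
  proof (rule bij_betw_byWitness[where f' = "insert d"])
    show "(\<lambda>T. T - {d}) ` {T \<in> tilings R. d \<in> T} \<subseteq> tilings (R - d)"
    proof clarify
      fix T assume "T \<in> tilings R" "d \<in> T"
      with partition_on_insert[OF disj[OF this], of R]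
      show "T - {d} \<in> tilings (R - d)" by (auto simp: tilings_def insert_absorb)
    qed
    show "insert d ` tilings (R - d) \<subseteq> {T \<in> tilings R. d \<in> T}"
      using assms \<open>d \<noteq> {}\<close> notin by (auto simp: tilings_def partition_on_insert)
  qed (use notin in auto)
qed

text \<open>Classify the tilings by the partner \<open>w\<close> of the cell \<open>u\<close>. This is the expansion of a permanent along
  a row.\<close>

lemma card_tilings_expand:
  assumes "finite R" "u \<in> R"
  shows "card (tilings R) = (\<Sum>w | w \<in> R \<and> edge_adjacent u w. card (tilings (R - {u, w})))"
proof -
  let ?N = "{w. w \<in> R \<and> edge_adjacent u w}"
  have "tilings R = (\<Union>w\<in>?N. {T \<in> tilings R. {u, w} \<in> T})"
  proof (intro equalityI subsetI)
    fix T assume T: "T \<in> tilings R"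
    then obtain d where "d \<in> T" "u \<in> d" "domino d"
      using assms(2) by (auto simp: tilings_def partition_on_def)
    moreover from this obtain w where "edge_adjacent u w" "d = {u, w}"
      using domino_contains_edge by blast
    moreover have "d \<subseteq> R" using T \<open>d \<in> T\<close> by (auto simp: tilings_def partition_on_def)
    ultimately show "T \<in> (\<Union>w\<in>?N. {T \<in> tilings R. {u, w} \<in> T})"
      using T by blast
  qed auto
  also have "card \<dots> = (\<Sum>w\<in>?N. card {T \<in> tilings R. {u, w} \<in> T})"
  proof (rule card_UN_disjoint)
    show "\<forall>w\<in>?N. \<forall>w'\<in>?N. w \<noteq> w' \<longrightarrow>
        {T \<in> tilings R. {u, w} \<in> T} \<inter> {T \<in> tilings R. {u, w'} \<in> T} = {}"
    proof (intro ballI impI equals0I)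
      fix w w' T
      assume "w \<noteq> w'" and T: "T \<in> {T \<in> tilings R. {u, w} \<in> T} \<inter> {T \<in> tilings R. {u, w'} \<in> T}"
      then have "disjoint T" "{u, w} \<in> T" "{u, w'} \<in> T"
        by (auto simp: tilings_def partition_on_def)
      then have "{u, w} = {u, w'}"
        using disjointD[of T "{u, w}" "{u, w'}"] by fastforce
      with \<open>w \<noteq> w'\<close> show False by (auto simp: doubleton_eq_iff)
    qed
  qed (use assms in auto)
  also have "\<dots> = (\<Sum>w\<in>?N. card (tilings (R - {u, w})))"
    by (rule sum.cong) (use assms in \<open>auto intro!: card_tilings_containing simp: domino_pair_iff\<close>)
  finally show ?thesis .
qed

section \<open>A parity criterion\<close>

lemma even_sum_off_diagonal:
  fixes g :: "'a \<Rightarrow> 'a \<Rightarrow> nat"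
  assumes "finite A" and sym: "\<And>x y. g x y = g y x"
  shows "even (\<Sum>x\<in>A. \<Sum>y\<in>A - {x}. g x y)"
  using assms(1)
proof (induction A rule: finite_induct)
  case (insert a A)
  have "(\<Sum>y\<in>insert a A - {x}. g x y) = g x a + (\<Sum>y\<in>A - {x}. g x y)" if "x \<in> A" for x
  proof -
    have "insert a A - {x} = insert a (A - {x})" using that insert.hyps by auto
    then show ?thesis using insert.hyps by simp
  qed
  then have "(\<Sum>x\<in>insert a A. \<Sum>y\<in>insert a A - {x}. g x y)
      = (\<Sum>y\<in>A. g a y) + ((\<Sum>x\<in>A. g x a) + (\<Sum>x\<in>A. \<Sum>y\<in>A - {x}. g x y))"
    using insert.hyps by (simp add: sum.distrib)
  also have "(\<Sum>x\<in>A. g x a) = (\<Sum>y\<in>A. g a y)" by (simp add: sym)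
  finally show ?case using insert.IH by simp
qed simp

text \<open>The permanent form of ``a matrix whose columns indexed by \<open>F\<close> sum to zero modulo \<open>2\<close> is singular''.
  Fix \<open>v \<in> F\<close> and, for each \<open>u \<in> F\<close>, add up the numbers of tilings of \<open>R - {v, w}\<close> over the neighbours
  \<open>w\<close> of \<open>u\<close>: this replaces column \<open>v\<close> by column \<open>u\<close>. For \<open>u = v\<close> the result is the number of tilings
  of \<open>R\<close>. For \<open>u \<noteq> v\<close> two columns agree and the result is even: expanding at \<open>u\<close> once more gives a
  symmetric sum over ordered pairs of distinct neighbours of \<open>u\<close>. Summed over all \<open>u \<in> F\<close>, each \<open>w\<close>
  occurs once for each of its neighbours in \<open>F\<close>, so the total is even as well.\<close>

lemma even_card_tilings_if_even_neighbourhoods: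
  assumes "finite R" "F \<subseteq> R" "v \<in> F"
    and indep: "\<And>a b. a \<in> F \<Longrightarrow> b \<in> F \<Longrightarrow> \<not> edge_adjacent a b"
    and ev: "\<And>w. w \<in> R \<Longrightarrow> even (card {u \<in> F. edge_adjacent u w})"
  shows "even (card (tilings R))"
proof -
  define N where "N u = {w. w \<in> R \<and> edge_adjacent u w}" for u
  define t where "t w = card (tilings (R - {v, w}))" for w
  have fin: "finite F" "\<And>u. finite (N u)"
    using assms(1,2) by (auto simp: N_def intro: finite_subset)
  have others: "even (\<Sum>w\<in>N u. t w)" if u: "u \<in> F - {v}" for u
  proof -
    define g where "g w w' = card (tilings (R - {u, v, w, w'}))" for w w'
    have "t w = (\<Sum>w'\<in>N u - {w}. g w w')" if w: "w \<in> N u" for w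
    proof -
      have "u \<in> R - {v, w}"
        using u w assms(2) by (auto simp: N_def edge_adjacent_irrefl)
      then have "t w = (\<Sum>w' | w' \<in> R - {v, w} \<and> edge_adjacent u w'.
          card (tilings (R - {v, w} - {u, w'})))"
        unfolding t_def using assms(1) by (intro card_tilings_expand) auto
      also have "\<dots> = (\<Sum>w'\<in>N u - {w}. g w w')"
      proof (rule sum.cong)
        show "{w'. w' \<in> R - {v, w} \<and> edge_adjacent u w'} = N u - {w}"
          using indep[of u v] u assms(3) by (auto simp: N_def)
        show "card (tilings (R - {v, w} - {u, w'})) = g w w'" for w'
          unfolding g_def by (rule arg_cong[where f = "\<lambda>X. card (tilings X)"]) auto
      qed
      finally show ?thesis .
    qed
    then have "(\<Sum>w\<in>N u. t w) = (\<Sum>w\<in>N u. \<Sum>w'\<in>N u - {w}. g w w')" by simp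
    moreover have "g w w' = g w' w" for w w'
      by (simp add: g_def insert_commute)
    ultimately show ?thesis
      using even_sum_off_diagonal[OF fin(2), of g] by simp
  qed
  have "(\<Sum>u\<in>F. \<Sum>w\<in>N u. t w) = (\<Sum>w\<in>R. \<Sum>u | u \<in> F \<and> edge_adjacent u w. t w)"
    unfolding N_def by (rule sum.swap_restrict) (use fin assms(1) in auto)
  also have "even \<dots>"
    by (rule dvd_sum) (use ev in simp)
  finally have "even (\<Sum>u\<in>F. \<Sum>w\<in>N u. t w)" .
  moreover have "(\<Sum>u\<in>F. \<Sum>w\<in>N u. t w) = card (tilings R) + (\<Sum>u\<in>F - {v}. \<Sum>w\<in>N u. t w)"
  proof -
    have "card (tilings R) = (\<Sum>w\<in>N v. t w)"
      unfolding t_def N_def using assms(1-3) by (intro card_tilings_expand) auto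
    then show ?thesis
      using sum.remove[OF fin(1) assms(3), of "\<lambda>u. \<Sum>w\<in>N u. t w"] by simp
  qed
  moreover have "even (\<Sum>u\<in>F - {v}. \<Sum>w\<in>N u. t w)"
    by (rule dvd_sum) (rule others)
  ultimately show ?thesis by simp
qed

section \<open>Symmetries\<close>

lemma card_tilings_image_le:
  assumes "finite R" "inj_on f R"
    and adj: "\<And>a b. a \<in> R \<Longrightarrow> b \<in> R \<Longrightarrow> edge_adjacent a b \<Longrightarrow> edge_adjacent (f a) (f b)"
  shows "card (tilings R) \<le> card (tilings (f ` R))"
proof (rule card_inj_on_le)
  have "tilings R \<subseteq> Pow (Pow R)" by (auto simp: tilings_def partition_on_def)
  moreover have "inj_on (image (image f)) (Pow (Pow R))"
    by (intro inj_on_image_Pow assms)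
  ultimately show "inj_on (image (image f)) (tilings R)" by (rule inj_on_subset[rotated])
  show "image (image f) ` tilings R \<subseteq> tilings (f ` R)"
  proof clarify
    fix T assume T: "T \<in> tilings R"
    then have "partition_on (f ` R) (image f ` T - {{}})"
      using partition_on_inj_image[OF _ assms(2)] by (auto simp: tilings_def)
    moreover have dom: "domino (f ` d)" if "d \<in> T" for d
    proof -
      obtain a b where "edge_adjacent a b" "d = {a, b}"
        using T \<open>d \<in> T\<close> by (auto simp: tilings_def domino_def)
      moreover have "d \<subseteq> R" using T \<open>d \<in> T\<close> by (auto simp: tilings_def partition_on_def)
      ultimately show ?thesis using adj by (auto simp: domino_pair_iff)
    qed
    moreover have "{} \<notin> image f ` T"
      using T by (auto simp: tilings_def partition_on_def)
    ultimately show "image f ` T \<in> tilings (f ` R)" by (auto simp: tilings_def)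
  qed
qed (use assms in auto)

lemma card_tilings_involution:
  assumes "finite R" "finite R'"
    and f: "\<And>a. a \<in> R \<Longrightarrow> f a \<in> R' \<and> f (f a) = a" "\<And>a. a \<in> R' \<Longrightarrow> f a \<in> R \<and> f (f a) = a"
    and adj: "\<And>a b. a \<in> R \<Longrightarrow> b \<in> R \<Longrightarrow> edge_adjacent a b \<Longrightarrow> edge_adjacent (f a) (f b)"
      "\<And>a b. a \<in> R' \<Longrightarrow> b \<in> R' \<Longrightarrow> edge_adjacent a b \<Longrightarrow> edge_adjacent (f a) (f b)"
  shows "card (tilings R) = card (tilings R')"
proof (rule antisym)
  have inj: "inj_on f R" "inj_on f R'"
    by (metis f(1) inj_onI) (metis f(2) inj_onI)
  have "f ` R = R'" "f ` R' = R"
    using f by (metis (no_types, lifting) image_iff image_subsetI subsetI subset_antisym)+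
  then show "card (tilings R) \<le> card (tilings R')" "card (tilings R') \<le> card (tilings R)"
    using card_tilings_image_le[OF assms(1) inj(1) adj(1)]
      card_tilings_image_le[OF assms(2) inj(2) adj(2)] by simp_all
qed

lemma card_tilings_rectangle_transpose:
  "card (tilings (rectangle m n)) = card (tilings (rectangle n m))"
  by (rule card_tilings_involution[where f = prod.swap])
    (auto simp: rectangle_def edge_adjacent_def)

section \<open>Cutting a region in two\<close>

text \<open>Once the crossing dominoes \<open>D\<close> are prescribed, the two sides are tiled independently: a tiling
  corresponds to the pair of its parts inside \<open>A\<close> and inside \<open>B\<close>.\<close>

lemma card_tilings_with_crossing_set:
  assumes "finite A" "finite B" "A \<inter> B = {}" "disjoint C"
    and crossing: "\<And>c. c \<in> C \<Longrightarrow> domino c \<and> c \<subseteq> A \<union> B \<and> \<not> c \<subseteq> A \<and> \<not> c \<subseteq> B"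
    and only: "\<And>d. domino d \<Longrightarrow> d \<subseteq> A \<union> B \<Longrightarrow> d \<subseteq> A \<or> d \<subseteq> B \<or> d \<in> C"
    and "D \<subseteq> C"
  shows "card {T \<in> tilings (A \<union> B). T \<inter> C = D}
    = card (tilings (A - \<Union>D)) * card (tilings (B - \<Union>D))"
proof -
  have disjD: "disjoint D" using assms(4,7) pairwise_subset by blast
  have "bij_betw (\<lambda>T. (T \<inter> Pow A, T \<inter> Pow B)) {T \<in> tilings (A \<union> B). T \<inter> C = D}
      (tilings (A - \<Union>D) \<times> tilings (B - \<Union>D))"
  proof (rule bij_betw_byWitness[where f' = "\<lambda>(P, Q). P \<union> Q \<union> D"])
    have split: "T = (T \<inter> Pow A) \<union> (T \<inter> Pow B) \<union> D"
      if "T \<in> tilings (A \<union> B)" "T \<inter> C = D" for T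
      using that only by (force simp: tilings_def partition_on_def)
    then show "\<forall>T\<in>{T \<in> tilings (A \<union> B). T \<inter> C = D}.
        (case (T \<inter> Pow A, T \<inter> Pow B) of (P, Q) \<Rightarrow> P \<union> Q \<union> D) = T"
      by auto
    have sub: "P \<subseteq> Pow A \<and> {} \<notin> P \<and> P \<inter> Pow B = {} \<and> P \<inter> C = {}"
      if "P \<in> tilings (A - \<Union>D)" for P
    proof -
      have 1: "P \<subseteq> Pow A" "{} \<notin> P" using that by (auto simp: tilings_def partition_on_def)
      moreover have "P \<inter> C = {}" using 1 crossing by blast
      moreover have "P \<inter> Pow B \<subseteq> {{}}" using 1(1) assms(3) by blast
      then have "P \<inter> Pow B = {}" using 1(2) by blast
      ultimately show ?thesis by blast
    qed
    have sub': "Q \<subseteq> Pow B \<and> {} \<notin> Q \<and> Q \<inter> Pow A = {} \<and> Q \<inter> C = {}"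
      if "Q \<in> tilings (B - \<Union>D)" for Q
    proof -
      have 1: "Q \<subseteq> Pow B" "{} \<notin> Q" using that by (auto simp: tilings_def partition_on_def)
      moreover have "Q \<inter> C = {}" using 1 crossing by blast
      moreover have "Q \<inter> Pow A \<subseteq> {{}}" using 1(1) assms(3) by blast
      then have "Q \<inter> Pow A = {}" using 1(2) by blast
      ultimately show ?thesis by blast
    qed
    have D: "D \<inter> Pow A = {}" "D \<inter> Pow B = {}" "D \<inter> C = D"
      using assms(7) crossing by auto
    show "\<forall>PQ\<in>tilings (A - \<Union>D) \<times> tilings (B - \<Union>D).
        (\<lambda>T. (T \<inter> Pow A, T \<inter> Pow B)) (case PQ of (P, Q) \<Rightarrow> P \<union> Q \<union> D) = PQ"
    proof (rule ballI, elim SigmaE)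
      fix PQ P Q assume "P \<in> tilings (A - \<Union>D)" "Q \<in> tilings (B - \<Union>D)" and PQ: "PQ = (P, Q)"
      then have "(P \<union> Q \<union> D) \<inter> Pow A = P" "(P \<union> Q \<union> D) \<inter> Pow B = Q"
        using sub[of P] sub'[of Q] D by (simp_all add: Int_Un_distrib2 Int_absorb2)
      then show "(\<lambda>T. (T \<inter> Pow A, T \<inter> Pow B)) (case PQ of (P, Q) \<Rightarrow> P \<union> Q \<union> D) = PQ"
        by (simp add: PQ)
    qed
    show "(\<lambda>T. (T \<inter> Pow A, T \<inter> Pow B)) ` {T \<in> tilings (A \<union> B). T \<inter> C = D}
        \<subseteq> tilings (A - \<Union>D) \<times> tilings (B - \<Union>D)"
    proof (rule image_subsetI)
      fix T assume "T \<in> {T \<in> tilings (A \<union> B). T \<inter> C = D}"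
      then have T: "T \<in> tilings (A \<union> B)" "D = T \<inter> C" by auto
      have U: "\<Union>T = A \<union> B" and dj: "disjoint T" and ne: "{} \<notin> T" and dom: "\<forall>d\<in>T. domino d"
        using T by (auto simp: tilings_def partition_on_def)
      have sp: "T = (T \<inter> Pow A) \<union> (T \<inter> Pow B) \<union> D" using split T by blast
      have apart: "X \<inter> Y = {}" if "X \<in> T" "Y \<in> D" "X \<noteq> Y" for X Y
        using that T dj by (auto simp: disjoint_def)
      have "\<Union>(T \<inter> Pow A) = A - \<Union>D"
      proof (intro equalityI subsetI)
        fix x assume "x \<in> \<Union>(T \<inter> Pow A)"
        then show "x \<in> A - \<Union>D" using apart D by blast
      next
        fix x assume x: "x \<in> A - \<Union>D"
        then obtain X where "X \<in> T" "x \<in> X" using U by blast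
        then show "x \<in> \<Union>(T \<inter> Pow A)" using x sp assms(3) by blast
      qed
      moreover have "\<Union>(T \<inter> Pow B) = B - \<Union>D"
      proof (intro equalityI subsetI)
        fix x assume "x \<in> \<Union>(T \<inter> Pow B)"
        then show "x \<in> B - \<Union>D" using apart D by blast
      next
        fix x assume x: "x \<in> B - \<Union>D"
        then obtain X where "X \<in> T" "x \<in> X" using U by blast
        then show "x \<in> \<Union>(T \<inter> Pow B)" using x sp assms(3) by blast
      qed
      moreover have "disjoint (T \<inter> Pow A)" "disjoint (T \<inter> Pow B)"
        using dj by (auto simp: disjoint_def)
      ultimately show "(T \<inter> Pow A, T \<inter> Pow B) \<in> tilings (A - \<Union>D) \<times> tilings (B - \<Union>D)"
        using ne dom by (auto simp: tilings_def partition_on_def)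
    qed
    show "(\<lambda>(P, Q). P \<union> Q \<union> D) ` (tilings (A - \<Union>D) \<times> tilings (B - \<Union>D))
        \<subseteq> {T \<in> tilings (A \<union> B). T \<inter> C = D}"
    proof (rule image_subsetI, elim SigmaE)
      fix PQ P Q assume P: "P \<in> tilings (A - \<Union>D)" and Q: "Q \<in> tilings (B - \<Union>D)"
        and PQ: "PQ = (P, Q)"
      have U: "\<Union>P = A - \<Union>D" "\<Union>Q = B - \<Union>D" and dj: "disjoint P" "disjoint Q"
        and dom: "\<forall>d\<in>P \<union> Q. domino d"
        using P Q by (auto simp: tilings_def partition_on_def)
      have "\<Union>D \<subseteq> A \<union> B"
        using assms(7) crossing by (meson Union_least subset_iff)
      then have "\<Union>(P \<union> Q \<union> D) = A \<union> B" using U by auto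
      moreover have "disjoint (P \<union> Q)"
        by (rule disjoint_union) (use dj U assms(3) in auto)
      then have "disjoint (P \<union> Q \<union> D)"
        by (rule disjoint_union) (use disjD U in auto)
      moreover have "domino d" if "d \<in> P \<union> Q \<union> D" for d
        using that dom assms(7) crossing[of d] by auto
      moreover have "{} \<notin> P \<union> Q \<union> D"
        using sub[OF P] sub'[OF Q] assms(7) crossing[of "{}"] by auto
      ultimately have "P \<union> Q \<union> D \<in> tilings (A \<union> B)"
        by (auto simp: tilings_def partition_on_def)
      moreover have "(P \<union> Q \<union> D) \<inter> C = D"
        using sub[OF P] sub'[OF Q] D by (simp add: Int_Un_distrib2)
      ultimately show "(case PQ of (P, Q) \<Rightarrow> P \<union> Q \<union> D) \<in> {T \<in> tilings (A \<union> B). T \<inter> C = D}"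
        by (simp add: PQ)
    qed
  qed
  then show ?thesis
    by (simp add: bij_betw_same_card card_cartesian_product)
qed

lemma card_tilings_cut:
  assumes "finite A" "finite B" "A \<inter> B = {}" "disjoint C"
    and crossing: "\<And>c. c \<in> C \<Longrightarrow> domino c \<and> c \<subseteq> A \<union> B \<and> \<not> c \<subseteq> A \<and> \<not> c \<subseteq> B"
    and only: "\<And>d. domino d \<Longrightarrow> d \<subseteq> A \<union> B \<Longrightarrow> d \<subseteq> A \<or> d \<subseteq> B \<or> d \<in> C"
  shows "card (tilings (A \<union> B))
    = (\<Sum>D\<in>Pow C. card (tilings (A - \<Union>D)) * card (tilings (B - \<Union>D)))"
proof -
  have "finite C"
    using crossing assms(1,2) by (intro finite_subset[of C "Pow (A \<union> B)"]) auto
  have "(\<Sum>D\<in>Pow C. card {T \<in> tilings (A \<union> B). T \<inter> C = D})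
      = (\<Sum>D\<in>Pow C. card (tilings (A - \<Union>D)) * card (tilings (B - \<Union>D)))"
    by (intro sum.cong refl card_tilings_with_crossing_set assms) auto
  moreover have "card (tilings (A \<union> B)) = (\<Sum>D\<in>Pow C. card {T \<in> tilings (A \<union> B). T \<inter> C = D})"
  proof -
    have "tilings (A \<union> B) = (\<Union>D\<in>Pow C. {T \<in> tilings (A \<union> B). T \<inter> C = D})"
    proof (intro equalityI subsetI)
      fix T assume "T \<in> tilings (A \<union> B)"
      then show "T \<in> (\<Union>D\<in>Pow C. {T \<in> tilings (A \<union> B). T \<inter> C = D})"
        by (intro UN_I[of "T \<inter> C"]) simp_all
    next
      fix T assume "T \<in> (\<Union>D\<in>Pow C. {T \<in> tilings (A \<union> B). T \<inter> C = D})"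
      then show "T \<in> tilings (A \<union> B)" by (elim UN_E) simp
    qed
    also have "card \<dots> = (\<Sum>D\<in>Pow C. card {T \<in> tilings (A \<union> B). T \<inter> C = D})"
    proof (rule card_UN_disjoint)
      show "finite (Pow C)" "\<forall>D\<in>Pow C. finite {T \<in> tilings (A \<union> B). T \<inter> C = D}"
        using \<open>finite C\<close> assms(1,2) by simp_all
      show "\<forall>D\<in>Pow C. \<forall>E\<in>Pow C. D \<noteq> E \<longrightarrow>
          {T \<in> tilings (A \<union> B). T \<inter> C = D} \<inter> {T \<in> tilings (A \<union> B). T \<inter> C = E} = {}"
      proof (intro ballI impI equals0I)
        fix D E T
        assume "D \<noteq> E"
          and T: "T \<in> {T \<in> tilings (A \<union> B). T \<inter> C = D} \<inter> {T \<in> tilings (A \<union> B). T \<inter> C = E}"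
        have "T \<inter> C = D" using IntD1[OF T] by (elim CollectE conjE)
        moreover have "T \<inter> C = E" using IntD2[OF T] by (elim CollectE conjE)
        ultimately show False using \<open>D \<noteq> E\<close> by simp
      qed
    qed
    finally show ?thesis .
  qed
  ultimately show ?thesis by simp
qed

section \<open>The billiard rectangle in a square\<close>

text \<open>In the square with coordinates \<open>0, \<dots>, m\<close>, the diagonal billiard path through \<open>(m - c, m)\<close>
  reflects at \<open>(m, m - c)\<close>, \<open>(c, 0)\<close> and \<open>(0, c)\<close>. In the coordinates \<open>s = p + q\<close> and \<open>d = p - q\<close> it
  bounds the rectangle \<open>c \<le> s \<le> 2m - c\<close>, \<open>\<bar>d\<bar> \<le> c\<close>. The path alone need not meet every
  neighbourhood evenly; all cells of its colour inside the rectangle together do. The inequalities are arranged so that no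
  truncated subtraction occurs.\<close>

definition billiard_rectangle :: "nat \<Rightarrow> nat \<Rightarrow> cell set" where
  "billiard_rectangle m c = {(p, q). p \<le> q + c \<and> q \<le> p + c \<and> c \<le> p + q \<and> p + q + c \<le> 2 * m
     \<and> even (p + q + c)}"

lemma billiard_rectangle_independent:
  assumes "a \<in> billiard_rectangle m c" "b \<in> billiard_rectangle m c"
  shows "\<not> edge_adjacent a b"
  using assms unfolding billiard_rectangle_def edge_adjacent_def by auto

lemma card_neighbours:
  "card {u. edge_adjacent u (p, q) \<and> P u} =
     of_bool (P (Suc p, q)) + of_bool (P (p, Suc q)) +
     of_bool (0 < p \<and> P (p - 1, q)) + of_bool (0 < q \<and> P (p, q - 1))"
proof -
  let ?N = "{u. edge_adjacent u (p, q)}"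
  have N: "?N = insert (Suc p, q) (insert (p, Suc q)
      ((if 0 < p then {(p - 1, q)} else {}) \<union> (if 0 < q then {(p, q - 1)} else {})))"
    unfolding edge_adjacent_def by (cases p; cases q) auto
  have "finite ?N" unfolding N by simp
  then have "card {u. edge_adjacent u (p, q) \<and> P u} = (\<Sum>u\<in>?N. of_bool (P u))"
    by (simp add: sum_of_bool_eq Collect_conj_eq)
  also have "\<dots> = of_bool (P (Suc p, q)) + of_bool (P (p, Suc q)) +
     of_bool (0 < p \<and> P (p - 1, q)) + of_bool (0 < q \<and> P (p, q - 1))"
    unfolding N by (cases p; cases q) simp_all
  finally show ?thesis .
qed

text \<open>The four neighbours of a cell have coordinates \<open>(s \<plusminus> 1, d \<plusminus> 1)\<close>, all sign combinations occurring,
  and the billiard rectangle is a product in these coordinates. Hence, for a cell of the other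
  colour, the count is the product of the number of admissible values among \<open>s \<plusminus> 1\<close> and the number
  among \<open>d \<plusminus> 1\<close>. One factor is odd only if \<open>s\<close> lies just outside its range, the other only if \<open>d\<close>
  does. Both together cannot happen: the corresponding cells lie outside the square.\<close>

lemma even_card_neighbours_in_billiard_rectangle:
  assumes "p \<le> m" "q \<le> m"
  shows "even (card {u \<in> billiard_rectangle m c. edge_adjacent u (p, q)})"
proof -
  let ?F = "billiard_rectangle m c"
  have "even (card {u. edge_adjacent u (p, q) \<and> u \<in> ?F})"
  proof (cases "even (p + q + c)")
    case True
    then have "{u. edge_adjacent u (p, q) \<and> u \<in> ?F} = {}"
      by (auto simp: billiard_rectangle_def edge_adjacent_def)
    then show ?thesis by (simp only: card.empty even_zero)
  next
    case False
    \<comment> \<open>\<open>S1\<close> and \<open>S0\<close> say that \<open>s + 1\<close> and \<open>s - 1\<close> are in range, \<open>D1\<close> and \<open>D0\<close> the same for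
      \<open>d + 1\<close> and \<open>d - 1\<close>. Positivity of the coordinate that decreases is implied by the ranges.\<close>
    define S1 where "S1 \<longleftrightarrow> c \<le> p + q + 1 \<and> p + q + 1 + c \<le> 2 * m"
    define S0 where "S0 \<longleftrightarrow> c + 1 \<le> p + q \<and> p + q + c \<le> 2 * m + 1"
    define D1 where "D1 \<longleftrightarrow> p + 1 \<le> q + c \<and> q \<le> p + 1 + c"
    define D0 where "D0 \<longleftrightarrow> p \<le> q + 1 + c \<and> q + 1 \<le> p + c"
    have nbr: "(Suc p, q) \<in> ?F \<longleftrightarrow> S1 \<and> D1" "(p, Suc q) \<in> ?F \<longleftrightarrow> S1 \<and> D0"
      "0 < p \<and> (p - 1, q) \<in> ?F \<longleftrightarrow> S0 \<and> D0" "0 < q \<and> (p, q - 1) \<in> ?F \<longleftrightarrow> S0 \<and> D1"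
      using False unfolding billiard_rectangle_def S1_def S0_def D1_def D0_def by auto
    \<comment> \<open>By colour, \<open>s\<close> and \<open>d\<close> are never equal to an end of their range.\<close>
    have "p + q \<noteq> c" "p + q + c \<noteq> 2 * m" "p \<noteq> q + c" "q \<noteq> p + c"
      using False by presburger+
    then have S: "p + q + 1 = c \<or> p + q + c = 2 * m + 1" if "S1 \<noteq> S0"
      using that unfolding S1_def S0_def by auto
    have D: "p = q + c + 1 \<or> q = p + c + 1" if "D1 \<noteq> D0"
      using that \<open>p \<noteq> q + c\<close> \<open>q \<noteq> p + c\<close> unfolding D1_def D0_def by auto
    have "S1 = S0 \<or> D1 = D0"
      using S D assms by (cases "S1 = S0"; cases "D1 = D0") auto
    then show ?thesis
      unfolding card_neighbours nbr by (cases S1; cases S0; cases D1; cases D0) simp_all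
  qed
  moreover have "{u. edge_adjacent u (p, q) \<and> u \<in> ?F} = {u \<in> ?F. edge_adjacent u (p, q)}" by blast
  ultimately show ?thesis by simp
qed

section \<open>Cutting a rectangle between two columns\<close>

definition crossing_dominoes :: "nat \<Rightarrow> nat \<Rightarrow> cell set set" where
  "crossing_dominoes n j = (\<lambda>i. {(i, j), (i, Suc j)}) ` {..<n}"

lemma finite_crossing_dominoes [simp]: "finite (crossing_dominoes n j)"
  by (simp add: crossing_dominoes_def)

lemma Union_crossing_dominoes: "\<Union>(crossing_dominoes n j) = {..<n} \<times> {j, Suc j}"
  unfolding crossing_dominoes_def by blast

lemma mem_Union_crossing_dominoes_iff:
  assumes "D \<subseteq> crossing_dominoes n j"
  shows "(p, q) \<in> \<Union>D \<longleftrightarrow> {(p, j), (p, Suc j)} \<in> D \<and> (q = j \<or> q = Suc j)"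
proof
  assume "(p, q) \<in> \<Union>D"
  then obtain d where d: "d \<in> D" "(p, q) \<in> d" by blast
  then obtain i where "d = {(i, j), (i, Suc j)}"
    using assms unfolding crossing_dominoes_def by blast
  with d show "{(p, j), (p, Suc j)} \<in> D \<and> (q = j \<or> q = Suc j)" by auto
next
  assume "{(p, j), (p, Suc j)} \<in> D \<and> (q = j \<or> q = Suc j)"
  then show "(p, q) \<in> \<Union>D" by (intro UnionI[of "{(p, j), (p, Suc j)}"]) auto
qed

lemma card_tilings_rectangle_cut:
  assumes "Suc j < w"
  shows "card (tilings (rectangle n w)) =
    (\<Sum>D\<in>Pow (crossing_dominoes n j). card (tilings (rectangle n (Suc j) - \<Union>D)) *
      card (tilings (rectangle n w - rectangle n (Suc j) - \<Union>D)))"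
proof -
  let ?A = "rectangle n (Suc j)" and ?B = "rectangle n w - rectangle n (Suc j)"
  have union: "rectangle n w = ?A \<union> ?B"
    using assms by (auto simp: rectangle_def)
  have "card (tilings (?A \<union> ?B)) = (\<Sum>D\<in>Pow (crossing_dominoes n j).
      card (tilings (?A - \<Union>D)) * card (tilings (?B - \<Union>D)))"
  proof (rule card_tilings_cut)
    show "disjoint (crossing_dominoes n j)"
      by (auto simp: disjoint_def crossing_dominoes_def)
    show "domino c \<and> c \<subseteq> ?A \<union> ?B \<and> \<not> c \<subseteq> ?A \<and> \<not> c \<subseteq> ?B" if "c \<in> crossing_dominoes n j" for c
      using that assms
      by (auto simp: crossing_dominoes_def rectangle_def domino_pair_iff edge_adjacent_def)
    show "d \<subseteq> ?A \<or> d \<subseteq> ?B \<or> d \<in> crossing_dominoes n j" if "domino d" "d \<subseteq> ?A \<union> ?B" for d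
    proof -
      obtain p q p' q' where d: "d = {(p, q), (p', q')}" and "edge_adjacent (p, q) (p', q')"
        using \<open>domino d\<close> unfolding domino_def by (metis surj_pair)
      then consider "p = p'" "q' = Suc q" | "p = p'" "q = Suc q'" | "q = q'"
        by (auto simp: edge_adjacent_def)
      then show ?thesis
        using that(2) d
        by cases (auto simp: rectangle_def crossing_dominoes_def insert_commute less_Suc_eq_le
            le_less_Suc_eq)
    qed
  qed auto
  then show ?thesis using union by simp
qed

section \<open>Squares with part of the last column removed\<close>

text \<open>A crossing domino missing from \<open>D\<close> leaves its cell \<open>(i, m)\<close> in the region. The billiard rectangle
  with corner \<open>(i, m)\<close> touches the last column nowhere else, so it survives the removal of \<open>D\<close>.\<close>

lemma even_card_tilings_square_minus_proper_crossings:
  assumes "D \<subset> crossing_dominoes (Suc m) m"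
  shows "even (card (tilings (rectangle (Suc m) (Suc m) - \<Union>D)))"
proof -
  have D: "D \<subseteq> crossing_dominoes (Suc m) m" using assms by auto
  obtain i where i: "i \<le> m" "{(i, m), (i, Suc m)} \<notin> D"
    using assms unfolding crossing_dominoes_def by fastforce
  let ?F = "billiard_rectangle m (m - i)" and ?R = "rectangle (Suc m) (Suc m) - \<Union>D"
  show ?thesis
  proof (rule even_card_tilings_if_even_neighbourhoods[where F = ?F and v = "(i, m)"])
    show "?F \<subseteq> ?R"
    proof clarify
      fix p q assume pq: "(p, q) \<in> ?F"
      then have "p \<le> m" "q \<le> m" and last: "q = m \<Longrightarrow> p = i"
        using i(1) by (auto simp: billiard_rectangle_def)
      moreover have "(p, q) \<notin> \<Union>D"
        using mem_Union_crossing_dominoes_iff[OF D, of p q] last \<open>q \<le> m\<close> i(2) by auto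
      ultimately show "(p, q) \<in> ?R" by (simp add: rectangle_def)
    qed
    show "(i, m) \<in> ?F" using i(1) by (auto simp: billiard_rectangle_def)
    show "even (card {u \<in> ?F. edge_adjacent u w})" if "w \<in> ?R" for w
      using that even_card_neighbours_in_billiard_rectangle[of "fst w" m "snd w"]
      by (auto simp: rectangle_def)
  qed (use billiard_rectangle_independent in auto)
qed

lemma square_minus_all_crossings:
  "rectangle (Suc m) (Suc m) - \<Union>(crossing_dominoes (Suc m) m) = rectangle (Suc m) m"
  unfolding Union_crossing_dominoes rectangle_def by auto

text \<open>Cutting off the last column leaves a square. Only the full set of crossing dominoes contributes an
  odd term; it covers the cut-off column completely and leaves the previous almost-square.\<close>

lemma odd_card_tilings_almost_square: "odd (card (tilings (rectangle k (Suc k))))"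
proof (induction k)
  case 0
  then show ?case by (simp add: rectangle_def tilings_empty)
next
  case (Suc m)
  let ?C = "crossing_dominoes (Suc m) m"
  define x where "x D = card (tilings (rectangle (Suc m) (Suc m) - \<Union>D))" for D
  define y where "y D = card (tilings
      (rectangle (Suc m) (Suc (Suc m)) - rectangle (Suc m) (Suc m) - \<Union>D))" for D
  have "card (tilings (rectangle (Suc m) (Suc (Suc m)))) = (\<Sum>D\<in>Pow ?C. x D * y D)"
    unfolding x_def y_def by (rule card_tilings_rectangle_cut) simp
  also have "\<dots> = x ?C * y ?C + (\<Sum>D\<in>Pow ?C - {?C}. x D * y D)"
    by (rule sum.remove) auto
  finally have "card (tilings (rectangle (Suc m) (Suc (Suc m))))
      = x ?C * y ?C + (\<Sum>D\<in>Pow ?C - {?C}. x D * y D)" .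
  moreover have "even (\<Sum>D\<in>Pow ?C - {?C}. x D * y D)"
  proof (rule dvd_sum)
    fix D assume "D \<in> Pow ?C - {?C}"
    then have "even (x D)"
      unfolding x_def by (intro even_card_tilings_square_minus_proper_crossings) auto
    then show "even (x D * y D)" by simp
  qed
  moreover have "odd (x ?C)"
    unfolding x_def square_minus_all_crossings
    using Suc.IH by (simp add: card_tilings_rectangle_transpose)
  moreover have "rectangle (Suc m) (Suc (Suc m)) - rectangle (Suc m) (Suc m) - \<Union>?C = {}"
    unfolding Union_crossing_dominoes rectangle_def by auto
  then have "y ?C = 1"
    unfolding y_def by (simp only: tilings_empty) simp
  ultimately show ?case by simp
qed

text \<open>The reflection that exchanges the two halves of the \<open>n \<times> (2m + 2)\<close> rectangle maps every domino across
  the middle to itself.\<close>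

lemma card_tilings_halves_eq:
  assumes D: "D \<subseteq> crossing_dominoes n m"
  shows "card (tilings (rectangle n (2 * Suc m) - rectangle n (Suc m) - \<Union>D))
    = card (tilings (rectangle n (Suc m) - \<Union>D))"
proof (rule card_tilings_involution[where f = "\<lambda>(p, q). (p, 2 * m + 1 - q)"])
  have mem: "(p, 2 * m + 1 - q) \<in> \<Union>D \<longleftrightarrow> (p, q) \<in> \<Union>D" if "q \<le> 2 * m + 1" for p q
    unfolding mem_Union_crossing_dominoes_iff[OF D] using that by auto
  show "(case a of (p, q) \<Rightarrow> (p, 2 * m + 1 - q)) \<in> rectangle n (Suc m) - \<Union>D \<and>
      (case case a of (p, q) \<Rightarrow> (p, 2 * m + 1 - q) of (p, q) \<Rightarrow> (p, 2 * m + 1 - q)) = a"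
    if "a \<in> rectangle n (2 * Suc m) - rectangle n (Suc m) - \<Union>D" for a
  proof (cases a)
    case (Pair p q)
    with that have q: "p < n" "Suc m \<le> q" "q \<le> 2 * m + 1" "(p, q) \<notin> \<Union>D"
      by (auto simp: rectangle_def simp del: Union_iff)
    then have "(p, 2 * m + 1 - q) \<notin> \<Union>D" using mem by simp
    then show ?thesis using q Pair by (simp add: rectangle_def del: Union_iff)
  qed
  show "(case a of (p, q) \<Rightarrow> (p, 2 * m + 1 - q))
        \<in> rectangle n (2 * Suc m) - rectangle n (Suc m) - \<Union>D \<and>
      (case case a of (p, q) \<Rightarrow> (p, 2 * m + 1 - q) of (p, q) \<Rightarrow> (p, 2 * m + 1 - q)) = a"
    if "a \<in> rectangle n (Suc m) - \<Union>D" for a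
  proof (cases a)
    case (Pair p q)
    with that have q: "p < n" "q \<le> m" "(p, q) \<notin> \<Union>D"
      by (auto simp: rectangle_def simp del: Union_iff)
    then have "(p, 2 * m + 1 - q) \<notin> \<Union>D" using mem by simp
    then show ?thesis using q Pair by (auto simp: rectangle_def simp del: Union_iff)
  qed
qed (auto simp: rectangle_def edge_adjacent_def)

theorem corollary11:
  fixes k :: nat
  assumes "k \<ge> 1"
  shows "[card (domino_tilings k (2 * k)) = 1] (mod 4)"
proof -
  obtain m where k: "k = Suc m" using assms by (cases k) auto
  let ?C = "crossing_dominoes k m"
  define x where "x D = card (tilings (rectangle k k - \<Union>D))" for D
  have "card (domino_tilings k (2 * k)) = (\<Sum>D\<in>Pow ?C. x D *
      card (tilings (rectangle k (2 * k) - rectangle k k - \<Union>D)))"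
    unfolding domino_tilings_eq_tilings_rectangle x_def k
    by (rule card_tilings_rectangle_cut) simp
  also have "\<dots> = (\<Sum>D\<in>Pow ?C. x D * x D)"
  proof (rule sum.cong[OF refl])
    fix D assume "D \<in> Pow ?C"
    then show "x D * card (tilings (rectangle k (2 * k) - rectangle k k - \<Union>D)) = x D * x D"
      using card_tilings_halves_eq[of D k m] by (simp add: x_def k)
  qed
  also have "\<dots> = x ?C * x ?C + (\<Sum>D\<in>Pow ?C - {?C}. x D * x D)"
    by (rule sum.remove) auto
  finally have total: "card (domino_tilings k (2 * k))
      = x ?C * x ?C + (\<Sum>D\<in>Pow ?C - {?C}. x D * x D)" .
  have "4 dvd (\<Sum>D\<in>Pow ?C - {?C}. x D * x D)"
  proof (rule dvd_sum)
    fix D assume "D \<in> Pow ?C - {?C}"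
    then have "even (x D)"
      unfolding x_def k by (intro even_card_tilings_square_minus_proper_crossings) auto
    then have "2 * 2 dvd x D * x D" by (intro mult_dvd_mono) auto
    then show "4 dvd x D * x D" by simp
  qed
  then obtain r where r: "(\<Sum>D\<in>Pow ?C - {?C}. x D * x D) = 4 * r" by (elim dvdE)
  have "odd (x ?C)"
    unfolding x_def k square_minus_all_crossings
    using odd_card_tilings_almost_square by (simp add: card_tilings_rectangle_transpose)
  then obtain s where "x ?C = 2 * s + 1" by (elim oddE)
  then have "card (domino_tilings k (2 * k)) = 4 * (s * s + s + r) + 1"
    unfolding total r by (simp add: algebra_simps)
  then show ?thesis by (simp add: cong_def)
qed

end
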